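(* Let $\mathcal{C}\text{-}(\mathbb{T},V)\text{-}\mathsf{Cat}$ be the subcategory of $\mathsf{Qs}(\mathbb{T},V)\text{-}\mathsf{Cat}$ whose objects are the quasi-spaces $(X,(Q_a(C,X))_{C\in\mathcal{C}})$ associated with the compactly generated $(\mathbb{T},V)$-spaces $(X,a)$ and whose morphisms are the $(\mathbb{T},V)$-continuous maps between the compactly generated spaces. Then $\mathcal{C}\text{-}(\mathbb{T},V)\text{-}\mathsf{Cat}$ is fully reflective in $\mathsf{Qs}(\mathbb{T},V)\text{-}\mathsf{Cat}$; that is, it is a full reflective subcategory of $\mathsf{Qs}(\mathbb{T},V)\text{-}\mathsf{Cat}$.
   Context: Setting. $V=(V,\otimes,k)$ is a unital commutative quantale (a complete lattice with a commutative associative operation $\otimes$ with unit $k$ that preserves arbitrary suprema in each variable) which is also a Heyting algebra (each $u\wedge(-)$ has a right adjoint); $\bot,\top$ denote bottom and top. A $V$-relation $r\colon X\nrightarrow Y$ is a map $r\colon X\times Y\to V$; composition is $(s\cdot r)(x,z)=\bigvee_{y}r(x,y)\otimes s(y,z)$, the order is componentwise, and $r^{\circ}(y,x)=r(x,y)$. A map $f\colon X\to Y$ is regarded as the $V$-relation with $f(x,y)=k$ if $f(x)=y$ and $\bot$ otherwise. $\mathbb{T}=(T,m,e)$ is a monad on $\mathsf{Set}$ satisfying (BC): $T$ preserves weak pullbacks and the naturality squares of $m$ are weak pullbacks. A lax extension of $\mathbb{T}$ to $V$-relations is fixed, sending $r\colon X\nrightarrow Y$ to $Tr\colon TX\nrightarrow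 TY$: it is monotone, $Ts\cdot Tr\le T(s\cdot r)$, it is flat (the extension satisfies $T1_X=1_{TX}$, so that it agrees with $T$ on maps), $T(r^{\circ})=(Tr)^{\circ}$, $e_Y\cdot r\le Tr\cdot e_X$ and $m_Y\cdot TTr\le Tr\cdot m_X$. A $(\mathbb{T},V)$-space is a pair $(X,a)$ with $a\colon TX\nrightarrow X$ a $V$-relation such that $1_X\le a\cdot e_X$ and $a\cdot Ta\le a\cdot m_X$. A map $f\colon(X,a)\to(Y,b)$ is $(\mathbb{T},V)$-continuous if $f\cdot a\le b\cdot Tf$, i.e. $a(\mathfrak{x},x)\le b(Tf(\mathfrak{x}),f(x))$ for all $\mathfrak{x}\in TX,x\in X$. These form the category $(\mathbb{T},V)\text{-}\mathsf{Cat}$, whose forgetful functor to $\mathsf{Set}$ is topological. A space $(X,a)$ is compact if $1_{TX}\le a^{\circ}\cdot a$, i.e. $k\le\bigvee_{x\in X}a(\mathfrak{x},x)\otimes a(\mathfrak{x},x)$ for all $\mathfrak{x}\in TX$; it is Hausdorff if $a\cdot a^{\circ}\le 1_X$, i.e. $\bot<a(\mathfrak{x},x)\otimes a(\mathfrak{x},y)$ implies $x=y$, and $a(\mathfrak{x},x)\otimes a(\mathfrak{x},x)\le k$, for all $\mathfrak{x}\in TX$, $x,y\in X$. $\mathcal{C}$ denotes the full subcategory of $(\mathbb{T},V)\text{-}\mathsf{Cat}$ of compact Hausdorff spaces. Standing assumptions: every constant map between $(\mathbb{T},V)$-spaces is continuous, and $\mathcal{C}$ is closed in $(\mathbb{T},V)\text{-}\mathsf{Cat}$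 under finite coproducts, binary products and equalizers. A $(\mathbb{T},V)$-space $(X,a)$ is compactly generated if $a$ is the final structure with respect to all continuous maps $C\to(X,a)$ with $C\in\mathcal{C}$; that is, for every space $(Y,b)$, a map $g\colon(X,a)\to(Y,b)$ is continuous iff $g\cdot p$ is continuous for every continuous $p\colon C\to(X,a)$ with $C\in\mathcal{C}$. For a map $\alpha\colon C\to X$ into a set $X$ and a finite family $(\alpha_i\colon C_i\to X)_{i\in I}$ of maps, with $C,C_i\in\mathcal{C}$, $\alpha$ is covered by $(\alpha_i)_{i\in I}$ if there is a surjective continuous map $\eta\colon\coprod_{i\in I}C_i\to C$ (coproduct in $(\mathbb{T},V)\text{-}\mathsf{Cat}$) such that $\alpha\cdot\eta$ is the map $\coprod_i C_i\to X$ induced by the $\alpha_i$. A quasi-$(\mathbb{T},V)$-space is a set $X$ together with, for each $C\in\mathcal{C}$, a set $Q(C,X)$ of functions from $C$ to $X$ (the admissible maps) such that: (QS1) $Q(C,X)$ contains all constant maps; (QS2) if $h\colon C_1\to C_2$ is continuous, $C_1,C_2\in\mathcal{C}$, and $\alpha\in Q(C_2,X)$, then $\alpha\cdot h\in Q(C_1,X)$; (QS3) $\alpha\in Q(C,X)$ if and only if $\alpha$ is covered by a (finite) family of admissible maps. A map $f\colon X\to Y$ between quasi-spaces is quasi-$(\mathbb{T},V)$-continuous if $f\cdot\alpha\in Q(C,Y)$ for all $C\in\mathcal{C}$ and $\alpha\in Q(C,X)$. Quasi-spaces and quasi-continuous maps form $\mathsf{Qs}(\mathbb{T},V)\text{-}\mathsf{Cat}$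 (still called a category although its objects do not form a class). The quasi-space associated with a $(\mathbb{T},V)$-space $(X,a)$ is $X$ with $Q_a(C,X)=\{\alpha\colon C\to(X,a)\mid\alpha\text{ is }(\mathbb{T},V)\text{-continuous}\}$ for each $C\in\mathcal{C}$. *)

theory Defs
  imports "HOL-Library.FuncSet" "HOL-Library.Equipollence"
begin

section \<open>Categories\<close>

text \<open>The composite of \<open>f : A \<rightarrow> B\<close> and \<open>g : B \<rightarrow> C\<close> is \<open>Comp K A B C g f\<close>.
  Hom-sets of distinct pairs of objects are not required to be disjoint; all operations on
  morphisms therefore take the objects as arguments.\<close>

record ('o, 'm) category =
  Obj :: "'o set"
  Hom :: "'o \<Rightarrow> 'o \<Rightarrow> 'm set"
  Comp :: "'o \<Rightarrow> 'o \<Rightarrow> 'o \<Rightarrow> 'm \<Rightarrow> 'm \<Rightarrow> 'm"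
  Ident :: "'o \<Rightarrow> 'm"

definition is_category :: "('o, 'm) category \<Rightarrow> bool" where
  "is_category K \<longleftrightarrow>
    (\<forall>A\<in>Obj K. Ident K A \<in> Hom K A A) \<and>
    (\<forall>A\<in>Obj K. \<forall>B\<in>Obj K. \<forall>C\<in>Obj K. \<forall>f\<in>Hom K A B. \<forall>g\<in>Hom K B C.
      Comp K A B C g f \<in> Hom K A C) \<and>
    (\<forall>A\<in>Obj K. \<forall>B\<in>Obj K. \<forall>f\<in>Hom K A B.
      Comp K A A B f (Ident K A) = f \<and> Comp K A B B (Ident K B) f = f) \<and>
    (\<forall>A\<in>Obj K. \<forall>B\<in>Obj K. \<forall>C\<in>Obj K. \<forall>D\<in>Obj K.
      \<forall>f\<in>Hom K A B. \<forall>g\<in>Hom K B C. \<forall>h\<in>Hom K C D.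
      Comp K A B D (Comp K B C D h g) f = Comp K A C D h (Comp K A B C g f))"

definition is_subcategory :: "('o, 'm) category \<Rightarrow> ('o, 'm) category \<Rightarrow> bool" where
  "is_subcategory S K \<longleftrightarrow>
    is_category S \<and> is_category K \<and>
    Obj S \<subseteq> Obj K \<and>
    (\<forall>A\<in>Obj S. \<forall>B\<in>Obj S. Hom S A B \<subseteq> Hom K A B) \<and>
    (\<forall>A\<in>Obj S. Ident S A = Ident K A) \<and>
    (\<forall>A\<in>Obj S. \<forall>B\<in>Obj S. \<forall>C\<in>Obj S. \<forall>f\<in>Hom S A B. \<forall>g\<in>Hom S B C.
      Comp S A B C g f = Comp K A B C g f)"

definition is_full_subcategory :: "('o, 'm) category \<Rightarrow> ('o, 'm) category \<Rightarrow> bool" where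
  "is_full_subcategory S K \<longleftrightarrow>
    is_subcategory S K \<and> (\<forall>A\<in>Obj S. \<forall>B\<in>Obj S. Hom S A B = Hom K A B)"

definition is_reflection ::
    "('o, 'm) category \<Rightarrow> ('o, 'm) category \<Rightarrow> 'o \<Rightarrow> 'o \<Rightarrow> 'm \<Rightarrow> bool" where
  "is_reflection S K B A r \<longleftrightarrow>
    A \<in> Obj S \<and> r \<in> Hom K B A \<and>
    (\<forall>A'\<in>Obj S. \<forall>f\<in>Hom K B A'. \<exists>!g. g \<in> Hom S A A' \<and> Comp K B A A' g r = f)"

definition is_reflective_subcategory :: "('o, 'm) category \<Rightarrow> ('o, 'm) category \<Rightarrow> bool" where
  "is_reflective_subcategory S K \<longleftrightarrow>
    is_subcategory S K \<and> (\<forall>B\<in>Obj K. \<exists>A r. is_reflection S K B A r)"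

definition is_coproduct ::
    "('o, 'm) category \<Rightarrow> 'i set \<Rightarrow> ('i \<Rightarrow> 'o) \<Rightarrow> 'o \<Rightarrow> ('i \<Rightarrow> 'm) \<Rightarrow> bool" where
  "is_coproduct K I F D \<iota> \<longleftrightarrow>
    D \<in> Obj K \<and> (\<forall>i\<in>I. F i \<in> Obj K \<and> \<iota> i \<in> Hom K (F i) D) \<and>
    (\<forall>Z\<in>Obj K. \<forall>f. (\<forall>i\<in>I. f i \<in> Hom K (F i) Z) \<longrightarrow>
      (\<exists>!h. h \<in> Hom K D Z \<and> (\<forall>i\<in>I. Comp K (F i) D Z h (\<iota> i) = f i)))"

definition is_binary_product ::
    "('o, 'm) category \<Rightarrow> 'o \<Rightarrow> 'o \<Rightarrow> 'o \<Rightarrow> 'm \<Rightarrow> 'm \<Rightarrow> bool" where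
  "is_binary_product K A B P p q \<longleftrightarrow>
    A \<in> Obj K \<and> B \<in> Obj K \<and> P \<in> Obj K \<and> p \<in> Hom K P A \<and> q \<in> Hom K P B \<and>
    (\<forall>Z\<in>Obj K. \<forall>f\<in>Hom K Z A. \<forall>g\<in>Hom K Z B.
      \<exists>!h. h \<in> Hom K Z P \<and> Comp K Z P A p h = f \<and> Comp K Z P B q h = g)"

definition is_equalizer ::
    "('o, 'm) category \<Rightarrow> 'o \<Rightarrow> 'o \<Rightarrow> 'm \<Rightarrow> 'm \<Rightarrow> 'o \<Rightarrow> 'm \<Rightarrow> bool" where
  "is_equalizer K A B f g E j \<longleftrightarrow>
    A \<in> Obj K \<and> B \<in> Obj K \<and> f \<in> Hom K A B \<and> g \<in> Hom K A B \<and>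
    E \<in> Obj K \<and> j \<in> Hom K E A \<and> Comp K E A B f j = Comp K E A B g j \<and>
    (\<forall>Z\<in>Obj K. \<forall>u\<in>Hom K Z A. Comp K Z A B f u = Comp K Z A B g u \<longrightarrow>
      (\<exists>!h. h \<in> Hom K Z E \<and> Comp K Z E A j h = u))"

definition closed_under_finite_coproducts :: "('o, 'm) category \<Rightarrow> 'o set \<Rightarrow> bool" where
  "closed_under_finite_coproducts K \<C> \<longleftrightarrow>
    (\<forall>(I::nat set) F D \<iota>. finite I \<and> (\<forall>i\<in>I. F i \<in> \<C>) \<and> is_coproduct K I F D \<iota> \<longrightarrow> D \<in> \<C>)"

definition closed_under_binary_products :: "('o, 'm) category \<Rightarrow> 'o set \<Rightarrow> bool" where
  "closed_under_binary_products K \<C> \<longleftrightarrow>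
    (\<forall>A\<in>\<C>. \<forall>B\<in>\<C>. \<forall>P p q. is_binary_product K A B P p q \<longrightarrow> P \<in> \<C>)"

definition closed_under_equalizers :: "('o, 'm) category \<Rightarrow> 'o set \<Rightarrow> bool" where
  "closed_under_equalizers K \<C> \<longleftrightarrow>
    (\<forall>A\<in>\<C>. \<forall>B\<in>\<C>. \<forall>f g E j. is_equalizer K A B f g E j \<longrightarrow> E \<in> \<C>)"

text \<open>The square \<open>g \<cdot> q = f \<cdot> p\<close> with \<open>p : P \<rightarrow> A\<close>, \<open>q : P \<rightarrow> B\<close>, \<open>f : A \<rightarrow> C\<close>, \<open>g : B \<rightarrow> C\<close>.\<close>

definition is_weak_pullback ::
    "('o, 'm) category \<Rightarrow> 'o \<Rightarrow> 'o \<Rightarrow> 'o \<Rightarrow> 'o \<Rightarrow> 'm \<Rightarrow> 'm \<Rightarrow> 'm \<Rightarrow> 'm \<Rightarrow> bool" where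
  "is_weak_pullback K P A B C p q f g \<longleftrightarrow>
    P \<in> Obj K \<and> A \<in> Obj K \<and> B \<in> Obj K \<and> C \<in> Obj K \<and>
    p \<in> Hom K P A \<and> q \<in> Hom K P B \<and> f \<in> Hom K A C \<and> g \<in> Hom K B C \<and>
    Comp K P A C f p = Comp K P B C g q \<and>
    (\<forall>Z\<in>Obj K. \<forall>u\<in>Hom K Z A. \<forall>v\<in>Hom K Z B. Comp K Z A C f u = Comp K Z B C g v \<longrightarrow>
      (\<exists>w\<in>Hom K Z P. Comp K Z P A p w = u \<and> Comp K Z P B q w = v))"

text \<open>The category of sets.  The elements of all sets are drawn from one infinite type \<open>'u\<close>, and
  the sets in question are the subsets of \<open>'u\<close> of cardinality smaller than that of \<open>'u\<close>.  If the
  cardinality of \<open>'u\<close> is strongly inaccessible, this is (up to equivalence) the category of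
  sets of a Grothendieck universe.  Maps are represented by extensional functions.\<close>

definition Set_cat :: "('u set, 'u \<Rightarrow> 'u) category" where
  "Set_cat = \<lparr>Obj = {X. X \<prec> (UNIV :: 'u set)}, Hom = (\<lambda>X Y. X \<rightarrow>\<^sub>E Y),
    Comp = (\<lambda>X Y Z g f. compose X g f), Ident = (\<lambda>X. \<lambda>x\<in>X. x)\<rparr>"


section \<open>Quantales and V-relations\<close>

text \<open>The tensor is written \<open>*\<close> and its unit \<open>k\<close> is written \<open>1\<close>.\<close>

class comm_quantale = complete_lattice + comm_monoid_mult +
  assumes mult_Sup: "u * Sup A = (SUP v\<in>A. u * v)"

class heyting_quantale = comm_quantale +
  assumes heyting: "\<exists>h. \<forall>v w. inf u v \<le> w \<longleftrightarrow> v \<le> h w"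

text \<open>A V-relation from \<open>X\<close> to \<open>Y\<close> is represented by a function on the whole type that is
  \<open>\<bottom>\<close> outside \<open>X \<times> Y\<close>.  As \<open>\<bottom>\<close> is absorbing for \<open>*\<close>, the supremum in the composite may then be
  taken over the whole type, and equality and order of V-relations are those of functions.\<close>

type_synonym ('u, 'v) vrel = "'u \<Rightarrow> 'u \<Rightarrow> 'v"

definition VRel :: "'u set \<Rightarrow> 'u set \<Rightarrow> ('u, 'v::heyting_quantale) vrel set" where
  "VRel X Y = {r. \<forall>x y. \<not> (x \<in> X \<and> y \<in> Y) \<longrightarrow> r x y = bot}"

definition vcomp :: "('u, 'v::heyting_quantale) vrel \<Rightarrow> ('u, 'v) vrel \<Rightarrow> ('u, 'v) vrel"
    (infixl "\<cdot>" 70) where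
  "s \<cdot> r = (\<lambda>x z. SUP y. r x y * s y z)"

definition vconv :: "('u, 'v) vrel \<Rightarrow> ('u, 'v) vrel" where
  "vconv r = (\<lambda>y x. r x y)"

definition graph :: "'u set \<Rightarrow> ('u \<Rightarrow> 'u) \<Rightarrow> ('u, 'v::heyting_quantale) vrel" where
  "graph X f = (\<lambda>x y. if x \<in> X \<and> f x = y then 1 else bot)"

abbreviation vid :: "'u set \<Rightarrow> ('u, 'v::heyting_quantale) vrel" where
  "vid X \<equiv> graph X (\<lambda>x\<in>X. x)"


section \<open>Monads and their lax extensions\<close>

text \<open>\<open>TM M X Y f : TO M X \<rightarrow> TO M Y\<close> is the value of the functor at \<open>f : X \<rightarrow> Y\<close>, and
  \<open>TR M X Y r\<close> is the lax extension at the V-relation \<open>r\<close> from \<open>X\<close> to \<open>Y\<close>.\<close>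

record ('u, 'v) lax_monad =
  TO :: "'u set \<Rightarrow> 'u set"
  TM :: "'u set \<Rightarrow> 'u set \<Rightarrow> ('u \<Rightarrow> 'u) \<Rightarrow> ('u \<Rightarrow> 'u)"
  unit :: "'u set \<Rightarrow> ('u \<Rightarrow> 'u)"
  mult :: "'u set \<Rightarrow> ('u \<Rightarrow> 'u)"
  TR :: "'u set \<Rightarrow> 'u set \<Rightarrow> ('u, 'v) vrel \<Rightarrow> ('u, 'v) vrel"

definition is_endofunctor ::
    "('o, 'm) category \<Rightarrow> ('o \<Rightarrow> 'o) \<Rightarrow> ('o \<Rightarrow> 'o \<Rightarrow> 'm \<Rightarrow> 'm) \<Rightarrow> bool" where
  "is_endofunctor K F Fm \<longleftrightarrow>
    (\<forall>A\<in>Obj K. F A \<in> Obj K) \<and>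
    (\<forall>A\<in>Obj K. \<forall>B\<in>Obj K. \<forall>f\<in>Hom K A B. Fm A B f \<in> Hom K (F A) (F B)) \<and>
    (\<forall>A\<in>Obj K. Fm A A (Ident K A) = Ident K (F A)) \<and>
    (\<forall>A\<in>Obj K. \<forall>B\<in>Obj K. \<forall>C\<in>Obj K. \<forall>f\<in>Hom K A B. \<forall>g\<in>Hom K B C.
      Fm A C (Comp K A B C g f) = Comp K (F A) (F B) (F C) (Fm B C g) (Fm A B f))"

definition is_monad ::
    "('o, 'm) category \<Rightarrow> ('o \<Rightarrow> 'o) \<Rightarrow> ('o \<Rightarrow> 'o \<Rightarrow> 'm \<Rightarrow> 'm) \<Rightarrow> ('o \<Rightarrow> 'm) \<Rightarrow> ('o \<Rightarrow> 'm) \<Rightarrow> bool" where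
  "is_monad K F Fm e m \<longleftrightarrow>
    is_endofunctor K F Fm \<and>
    (\<forall>A\<in>Obj K. e A \<in> Hom K A (F A) \<and> m A \<in> Hom K (F (F A)) (F A)) \<and>
    (\<forall>A\<in>Obj K. \<forall>B\<in>Obj K. \<forall>f\<in>Hom K A B.
      Comp K A B (F B) (e B) f = Comp K A (F A) (F B) (Fm A B f) (e A) \<and>
      Comp K (F (F A)) (F (F B)) (F B) (m B) (Fm (F A) (F B) (Fm A B f))
        = Comp K (F (F A)) (F A) (F B) (Fm A B f) (m A)) \<and>
    (\<forall>A\<in>Obj K.
      Comp K (F A) (F (F A)) (F A) (m A) (e (F A)) = Ident K (F A) \<and>
      Comp K (F A) (F (F A)) (F A) (m A) (Fm A (F A) (e A)) = Ident K (F A) \<and>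
      Comp K (F (F (F A))) (F (F A)) (F A) (m A) (m (F A))
        = Comp K (F (F (F A))) (F (F A)) (F A) (m A) (Fm (F (F A)) (F A) (m A)))"

definition set_monad :: "('u, 'v) lax_monad \<Rightarrow> bool" where
  "set_monad M \<longleftrightarrow> is_monad Set_cat (TO M) (TM M) (unit M) (mult M)"

definition BC :: "('u, 'v) lax_monad \<Rightarrow> bool" where
  "BC M \<longleftrightarrow>
    (\<forall>P A B C p q f g. is_weak_pullback Set_cat P A B C p q f g \<longrightarrow>
      is_weak_pullback Set_cat (TO M P) (TO M A) (TO M B) (TO M C)
        (TM M P A p) (TM M P B q) (TM M A C f) (TM M B C g)) \<and>
    (\<forall>A\<in>Obj Set_cat. \<forall>B\<in>Obj Set_cat. \<forall>f\<in>Hom Set_cat A B.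
      is_weak_pullback Set_cat (TO M (TO M A)) (TO M A) (TO M (TO M B)) (TO M B)
        (mult M A) (TM M (TO M A) (TO M B) (TM M A B f)) (TM M A B f) (mult M B))"

text \<open>Besides \<open>T 1\<^sub>X = 1\<^sub>T\<^sub>X\<close>, flatness includes that the extension agrees with the functor on maps.\<close>

definition flat_lax_extension :: "('u, 'v::heyting_quantale) lax_monad \<Rightarrow> bool" where
  "flat_lax_extension M \<longleftrightarrow>
    (\<forall>X\<in>Obj Set_cat. \<forall>Y\<in>Obj Set_cat. \<forall>r\<in>VRel X Y. TR M X Y r \<in> VRel (TO M X) (TO M Y)) \<and>
    (\<forall>X\<in>Obj Set_cat. \<forall>Y\<in>Obj Set_cat. \<forall>r\<in>VRel X Y. \<forall>s\<in>VRel X Y.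
      r \<le> s \<longrightarrow> TR M X Y r \<le> TR M X Y s) \<and>
    (\<forall>X\<in>Obj Set_cat. \<forall>Y\<in>Obj Set_cat. \<forall>Z\<in>Obj Set_cat. \<forall>r\<in>VRel X Y. \<forall>s\<in>VRel Y Z.
      TR M Y Z s \<cdot> TR M X Y r \<le> TR M X Z (s \<cdot> r)) \<and>
    (\<forall>X\<in>Obj Set_cat. TR M X X (vid X) = vid (TO M X)) \<and>
    (\<forall>X\<in>Obj Set_cat. \<forall>Y\<in>Obj Set_cat. \<forall>f\<in>Hom Set_cat X Y.
      TR M X Y (graph X f) = graph (TO M X) (TM M X Y f)) \<and>
    (\<forall>X\<in>Obj Set_cat. \<forall>Y\<in>Obj Set_cat. \<forall>r\<in>VRel X Y.
      TR M Y X (vconv r) = vconv (TR M X Y r)) \<and>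
    (\<forall>X\<in>Obj Set_cat. \<forall>Y\<in>Obj Set_cat. \<forall>r\<in>VRel X Y.
      graph Y (unit M Y) \<cdot> r \<le> TR M X Y r \<cdot> graph X (unit M X)) \<and>
    (\<forall>X\<in>Obj Set_cat. \<forall>Y\<in>Obj Set_cat. \<forall>r\<in>VRel X Y.
      graph (TO M (TO M Y)) (mult M Y) \<cdot> TR M (TO M X) (TO M Y) (TR M X Y r)
        \<le> TR M X Y r \<cdot> graph (TO M (TO M X)) (mult M X))"


section \<open>Spaces\<close>

type_synonym ('u, 'v) space = "'u set \<times> ('u, 'v) vrel"

definition is_space :: "('u, 'v::heyting_quantale) lax_monad \<Rightarrow> ('u, 'v) space \<Rightarrow> bool" where
  "is_space M A \<longleftrightarrow> (case A of (X, a) \<Rightarrow>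
    X \<in> Obj Set_cat \<and> a \<in> VRel (TO M X) X \<and>
    vid X \<le> a \<cdot> graph X (unit M X) \<and>
    a \<cdot> TR M (TO M X) X a \<le> a \<cdot> graph (TO M (TO M X)) (mult M X))"

definition is_continuous ::
    "('u, 'v::heyting_quantale) lax_monad \<Rightarrow> ('u, 'v) space \<Rightarrow> ('u, 'v) space \<Rightarrow> ('u \<Rightarrow> 'u) \<Rightarrow> bool" where
  "is_continuous M A B f \<longleftrightarrow> (case A of (X, a) \<Rightarrow> case B of (Y, b) \<Rightarrow>
    f \<in> X \<rightarrow>\<^sub>E Y \<and> graph X f \<cdot> a \<le> b \<cdot> graph (TO M X) (TM M X Y f))"

definition TV_cat :: "('u, 'v::heyting_quantale) lax_monad \<Rightarrow> (('u, 'v) space, 'u \<Rightarrow> 'u) category" where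
  "TV_cat M = \<lparr>Obj = {A. is_space M A}, Hom = (\<lambda>A B. {f. is_continuous M A B f}),
    Comp = (\<lambda>A B C g f. compose (fst A) g f), Ident = (\<lambda>A. \<lambda>x\<in>fst A. x)\<rparr>"

definition is_compact :: "('u, 'v::heyting_quantale) lax_monad \<Rightarrow> ('u, 'v) space \<Rightarrow> bool" where
  "is_compact M A \<longleftrightarrow> (case A of (X, a) \<Rightarrow> vid (TO M X) \<le> vconv a \<cdot> a)"

definition is_Hausdorff :: "('u, 'v::heyting_quantale) lax_monad \<Rightarrow> ('u, 'v) space \<Rightarrow> bool" where
  "is_Hausdorff M A \<longleftrightarrow> (case A of (X, a) \<Rightarrow> a \<cdot> vconv a \<le> vid X)"

definition CompHaus :: "('u, 'v::heyting_quantale) lax_monad \<Rightarrow> ('u, 'v) space set" where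
  "CompHaus M = {A. is_space M A \<and> is_compact M A \<and> is_Hausdorff M A}"

text \<open>The empty map counts as constant, even into the empty set.\<close>

definition constant_maps :: "'u set \<Rightarrow> 'u set \<Rightarrow> ('u \<Rightarrow> 'u) set" where
  "constant_maps X Y = {f \<in> X \<rightarrow>\<^sub>E Y. \<exists>c. \<forall>x\<in>X. f x = c}"

definition constants_continuous :: "('u, 'v::heyting_quantale) lax_monad \<Rightarrow> bool" where
  "constants_continuous M \<longleftrightarrow>
    (\<forall>A\<in>Obj (TV_cat M). \<forall>B\<in>Obj (TV_cat M). \<forall>f\<in>constant_maps (fst A) (fst B).
      f \<in> Hom (TV_cat M) A B)"

definition compactly_generated ::
    "('u, 'v::heyting_quantale) lax_monad \<Rightarrow> ('u, 'v) space \<Rightarrow> bool" where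
  "compactly_generated M A \<longleftrightarrow>
    A \<in> Obj (TV_cat M) \<and>
    (\<forall>B\<in>Obj (TV_cat M). \<forall>g\<in>fst A \<rightarrow>\<^sub>E fst B.
      g \<in> Hom (TV_cat M) A B \<longleftrightarrow>
      (\<forall>C\<in>CompHaus M. \<forall>p\<in>Hom (TV_cat M) C A. compose (fst C) g p \<in> Hom (TV_cat M) C B))"


section \<open>Quasi-spaces\<close>

text \<open>\<open>\<alpha> : C \<rightarrow> X\<close> is covered by the finite family \<open>\<alpha>s i : Cs i \<rightarrow> X\<close>.  The map induced by the family
  is the unique map on the coproduct whose composite with each injection \<open>\<iota> i\<close> is \<open>\<alpha>s i\<close>.\<close>

definition covered ::
    "('u, 'v::heyting_quantale) lax_monad \<Rightarrow> ('u, 'v) space \<Rightarrow> ('u \<Rightarrow> 'u) \<Rightarrow>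
      'i set \<Rightarrow> ('i \<Rightarrow> ('u, 'v) space) \<Rightarrow> ('i \<Rightarrow> 'u \<Rightarrow> 'u) \<Rightarrow> bool" where
  "covered M C \<alpha> I Cs \<alpha>s \<longleftrightarrow>
    (\<exists>D \<iota>. is_coproduct (TV_cat M) I Cs D \<iota> \<and>
      (\<exists>\<eta>\<in>Hom (TV_cat M) D C. \<eta> ` fst D = fst C \<and>
        (\<forall>i\<in>I. compose (fst (Cs i)) (compose (fst D) \<alpha> \<eta>) (\<iota> i) = \<alpha>s i)))"

text \<open>A quasi-space is a set \<open>X\<close> with a family \<open>Q\<close> indexed by the compact Hausdorff spaces; as a
  normalization, \<open>Q\<close> is empty at all other arguments.\<close>

type_synonym ('u, 'v) quasi_space = "'u set \<times> (('u, 'v) space \<Rightarrow> ('u \<Rightarrow> 'u) set)"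

definition is_quasi_space ::
    "('u, 'v::heyting_quantale) lax_monad \<Rightarrow> ('u, 'v) quasi_space \<Rightarrow> bool" where
  "is_quasi_space M A \<longleftrightarrow> (case A of (X, Q) \<Rightarrow>
    X \<in> Obj Set_cat \<and>
    (\<forall>C. C \<notin> CompHaus M \<longrightarrow> Q C = {}) \<and>
    (\<forall>C\<in>CompHaus M. Q C \<subseteq> fst C \<rightarrow>\<^sub>E X) \<and>
    (\<forall>C\<in>CompHaus M. constant_maps (fst C) X \<subseteq> Q C) \<and>
    (\<forall>C1\<in>CompHaus M. \<forall>C2\<in>CompHaus M. \<forall>h\<in>Hom (TV_cat M) C1 C2. \<forall>\<alpha>\<in>Q C2.
      compose (fst C1) \<alpha> h \<in> Q C1) \<and>
    (\<forall>C\<in>CompHaus M. \<forall>\<alpha>\<in>fst C \<rightarrow>\<^sub>E X. \<alpha> \<in> Q C \<longleftrightarrow>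
      (\<exists>(I::nat set) Cs \<alpha>s. finite I \<and> (\<forall>i\<in>I. Cs i \<in> CompHaus M \<and> \<alpha>s i \<in> Q (Cs i)) \<and>
        covered M C \<alpha> I Cs \<alpha>s)))"

definition quasi_continuous ::
    "('u, 'v::heyting_quantale) lax_monad \<Rightarrow> ('u, 'v) quasi_space \<Rightarrow> ('u, 'v) quasi_space \<Rightarrow>
      ('u \<Rightarrow> 'u) \<Rightarrow> bool" where
  "quasi_continuous M A B f \<longleftrightarrow>
    f \<in> fst A \<rightarrow>\<^sub>E fst B \<and>
    (\<forall>C\<in>CompHaus M. \<forall>\<alpha>\<in>snd A C. compose (fst C) f \<alpha> \<in> snd B C)"

definition Qs_cat ::
    "('u, 'v::heyting_quantale) lax_monad \<Rightarrow> (('u, 'v) quasi_space, 'u \<Rightarrow> 'u) category" where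
  "Qs_cat M = \<lparr>Obj = {A. is_quasi_space M A}, Hom = (\<lambda>A B. {f. quasi_continuous M A B f}),
    Comp = (\<lambda>A B C g f. compose (fst A) g f), Ident = (\<lambda>A. \<lambda>x\<in>fst A. x)\<rparr>"

definition assoc_quasi_space ::
    "('u, 'v::heyting_quantale) lax_monad \<Rightarrow> ('u, 'v) space \<Rightarrow> ('u, 'v) quasi_space" where
  "assoc_quasi_space M A =
    (fst A, \<lambda>C. if C \<in> CompHaus M then Hom (TV_cat M) C A else {})"

definition C_TV_cat ::
    "('u, 'v::heyting_quantale) lax_monad \<Rightarrow> (('u, 'v) quasi_space, 'u \<Rightarrow> 'u) category" where
  "C_TV_cat M = \<lparr>Obj = assoc_quasi_space M ` {A. compactly_generated M A},
    Hom = (\<lambda>A B. {f. \<exists>A' B'. compactly_generated M A' \<and> compactly_generated M B' \<and>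
      A = assoc_quasi_space M A' \<and> B = assoc_quasi_space M B' \<and> f \<in> Hom (TV_cat M) A' B'}),
    Comp = (\<lambda>A B C g f. compose (fst A) g f), Ident = (\<lambda>A. \<lambda>x\<in>fst A. x)\<rparr>"

end

theory Submission
  imports Defs
begin

text \<open>
  The reflection of a quasi-space \<open>(X, Q)\<close> is carried by the identity of \<open>X\<close>: equip \<open>X\<close> with the
  final structure \<open>a\<close> with respect to all admissible maps \<open>\<alpha> : C \<rightarrow> X\<close>.  Every admissible map is then
  continuous into \<open>(X, a)\<close>, so the identity is quasi-continuous and finality with respect to the
  admissible maps makes \<open>(X, a)\<close> compactly generated (\<open>final_compactly_generated\<close>).  If
  \<open>f : X \<rightarrow> (Y, b)\<close> is quasi-continuous, each \<open>f \<cdot> \<alpha>\<close> is continuous, whence \<open>f\<close> is continuous on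
  \<open>(X, a)\<close>; uniqueness is clear because the reflection is an identity map.  The final structure is
  the infimum of all structures that make the admissible maps continuous.  It has the universal
  property because structures can be pulled back along maps (\<open>initial_is_space\<close>).

  Fullness is the definition of compact generation.  The same argument shows that a compactly
  generated structure is determined by its quasi-space (\<open>assoc_inj\<close>), without which the
  continuous maps between compactly generated spaces would not compose to a category on the
  associated quasi-spaces.

  The point that uses compact Hausdorff spaces in earnest is that a space \<open>(X, a)\<close> has an associated
  quasi-space at all, namely that a map covered by continuous maps is continuous.  It holds because
  a continuous surjection from a compact space onto a Hausdorff space is a quotient
  (\<open>surjection_final\<close>), and because the injections of a coproduct are jointly epic even for
  maps of sets (\<open>coproduct_map_unique\<close>).
\<close>

section \<open>Composition of V-relations, pointwise\<close>

lemma mult_bot [simp]: "u * bot = (bot :: 'v::heyting_quantale)"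
  using mult_Sup[of u "{}"] by simp

lemma bot_mult [simp]: "bot * u = (bot :: 'v::heyting_quantale)"
  by (metis mult.commute mult_bot)

lemma mult_right_mono_quantale: "v \<le> w \<Longrightarrow> u * v \<le> u * (w :: 'v::heyting_quantale)"
proof -
  assume "v \<le> w"
  then have "u * w = (SUP x\<in>{v, w}. u * x)"
    using mult_Sup[of u "{v, w}"] by (simp add: sup_absorb2)
  then show "u * v \<le> u * w" by (metis SUP_upper insertI1)
qed

lemma mult_mono_quantale: "u \<le> u' \<Longrightarrow> v \<le> v' \<Longrightarrow> u * v \<le> u' * (v' :: 'v::heyting_quantale)"
  by (metis mult.commute mult_right_mono_quantale order_trans)

lemma vcomp_upper: "r x y * s y z \<le> (s \<cdot> r) x z"
  unfolding vcomp_def by (rule SUP_upper) simp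

lemma vcomp_le_iff: "(s \<cdot> r) x z \<le> w \<longleftrightarrow> (\<forall>y. r x y * s y z \<le> w)"
  unfolding vcomp_def by (auto simp: SUP_le_iff)

lemma vcomp_graph: "(b \<cdot> graph X f) x z = (if x \<in> X then b (f x) z else bot)"
proof (rule antisym)
  show "(b \<cdot> graph X f) x z \<le> (if x \<in> X then b (f x) z else bot)"
    by (auto simp: vcomp_le_iff graph_def)
  show "(if x \<in> X then b (f x) z else bot) \<le> (b \<cdot> graph X f) x z"
  proof (cases "x \<in> X")
    case True
    then have "graph X f x (f x) = (1 :: 'a)" by (simp add: graph_def)
    then show ?thesis using vcomp_upper[of "graph X f" x "f x" b z] True by simp
  qed simp
qed

lemma graph_vcomp_le_iff:
  "(graph X f \<cdot> a) x z \<le> w \<longleftrightarrow> (\<forall>y\<in>X. f y = z \<longrightarrow> a x y \<le> w)"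
  by (auto simp: vcomp_le_iff graph_def)

lemma VRel_bot: "r \<in> VRel X Y \<Longrightarrow> x \<notin> X \<or> y \<notin> Y \<Longrightarrow> r x y = bot"
  by (auto simp: VRel_def)

lemma vcomp_VRel: "r \<in> VRel X Y \<Longrightarrow> s \<in> VRel Y Z \<Longrightarrow> s \<cdot> r \<in> VRel X Z"
  by (auto simp: VRel_def vcomp_def intro!: bot_unique[THEN iffD1] SUP_least)

lemma graph_VRel: "f \<in> X \<rightarrow>\<^sub>E Y \<Longrightarrow> graph X f \<in> VRel X Y"
  by (auto simp: VRel_def graph_def)

lemma vconv_VRel: "r \<in> VRel X Y \<Longrightarrow> vconv r \<in> VRel Y X"
  by (auto simp: VRel_def vconv_def)

lemma compose_compose:
  "f \<in> A \<rightarrow> B \<Longrightarrow> compose A (compose B h g) f = compose A h (compose A g f)"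
  by (auto simp: compose_def fun_eq_iff)

lemma id_in_PiE: "(\<lambda>x\<in>X. x) \<in> X \<rightarrow>\<^sub>E X"
  by auto

lemma compose_id_left: "f \<in> X \<rightarrow>\<^sub>E Y \<Longrightarrow> compose X (\<lambda>y\<in>Y. y) f = f"
  by (auto simp: compose_def fun_eq_iff PiE_def extensional_def)

lemma compose_id_right: "f \<in> X \<rightarrow>\<^sub>E Y \<Longrightarrow> compose X f (\<lambda>x\<in>X. x) = f"
  by (auto simp: compose_def fun_eq_iff PiE_def extensional_def)

lemma compose_in_PiE: "f \<in> X \<rightarrow>\<^sub>E Y \<Longrightarrow> g \<in> Y \<rightarrow>\<^sub>E Z \<Longrightarrow> compose X g f \<in> X \<rightarrow>\<^sub>E Z"
  by (auto simp: compose_def)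


section \<open>Structures of spaces\<close>

locale lax_extended_monad =
  fixes M :: "('u, 'v::heyting_quantale) lax_monad"
  assumes monad: "set_monad M"
    and ext: "flat_lax_extension M"
begin

(* Spaces are pairs, but quantifiers over spaces are instantiated with spaces as a whole. *)
declare split_paired_All [simp del] split_paired_Ex [simp del]

abbreviation "small X \<equiv> X \<in> Obj (Set_cat :: ('u set, 'u \<Rightarrow> 'u) category)"

lemma endofunctor: "is_endofunctor Set_cat (TO M) (TM M)"
  using monad unfolding set_monad_def is_monad_def by (rule conjunct1)

lemma TO_small [simp]: "small X \<Longrightarrow> small (TO M X)"
  using endofunctor unfolding is_endofunctor_def by blast

lemma TM_in [intro]: "small X \<Longrightarrow> small Y \<Longrightarrow> f \<in> X \<rightarrow>\<^sub>E Y \<Longrightarrow> TM M X Y f \<in> TO M X \<rightarrow>\<^sub>E TO M Y"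
  using endofunctor[unfolded is_endofunctor_def, THEN conjunct2, THEN conjunct1]
  by (simp add: Set_cat_def)

lemma TM_id: "small X \<Longrightarrow> TM M X X (\<lambda>x\<in>X. x) = (\<lambda>x\<in>TO M X. x)"
  using endofunctor[unfolded is_endofunctor_def, THEN conjunct2, THEN conjunct2, THEN conjunct1]
  by (simp add: Set_cat_def)

lemma TM_compose:
  assumes "small X" "small Y" "small Z" "f \<in> X \<rightarrow>\<^sub>E Y" "g \<in> Y \<rightarrow>\<^sub>E Z"
  shows "TM M X Z (compose X g f) = compose (TO M X) (TM M Y Z g) (TM M X Y f)"
  using endofunctor[unfolded is_endofunctor_def, THEN conjunct2, THEN conjunct2, THEN conjunct2] assms
  by (simp add: Set_cat_def)

lemma unit_in: "small X \<Longrightarrow> unit M X \<in> X \<rightarrow>\<^sub>E TO M X"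
  using monad[unfolded set_monad_def is_monad_def, THEN conjunct2, THEN conjunct1]
  by (simp add: Set_cat_def)

lemma mult_in: "small X \<Longrightarrow> mult M X \<in> TO M (TO M X) \<rightarrow>\<^sub>E TO M X"
  using monad[unfolded set_monad_def is_monad_def, THEN conjunct2, THEN conjunct1]
  by (simp add: Set_cat_def)

lemma unit_natural:
  assumes "small X" "small Y" "f \<in> X \<rightarrow>\<^sub>E Y" "x \<in> X"
  shows "unit M Y (f x) = TM M X Y f (unit M X x)"
proof -
  have "compose X (unit M Y) f = compose X (TM M X Y f) (unit M X)"
    using monad[unfolded set_monad_def is_monad_def, THEN conjunct2, THEN conjunct2, THEN conjunct1]
      assms(1-3) by (simp add: Set_cat_def)
  from fun_cong[OF this, of x] show ?thesis using assms(4) by (simp add: compose_eq)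
qed

lemma mult_natural:
  assumes "small X" "small Y" "f \<in> X \<rightarrow>\<^sub>E Y" "x \<in> TO M (TO M X)"
  shows "mult M Y (TM M (TO M X) (TO M Y) (TM M X Y f) x) = TM M X Y f (mult M X x)"
proof -
  have "compose (TO M (TO M X)) (mult M Y) (TM M (TO M X) (TO M Y) (TM M X Y f))
      = compose (TO M (TO M X)) (TM M X Y f) (mult M X)"
    using monad[unfolded set_monad_def is_monad_def, THEN conjunct2, THEN conjunct2, THEN conjunct1,
        rule_format, of X Y f] assms(1-3) by (simp add: Set_cat_def)
  from fun_cong[OF this, of x] show ?thesis using assms(4) by (simp add: compose_eq)
qed

lemma TM_surj:
  assumes "small X" "small Y" "f \<in> X \<rightarrow>\<^sub>E Y" "f ` X = Y"
  shows "TM M X Y f ` TO M X = TO M Y"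
proof -
  define s where "s = (\<lambda>y\<in>Y. inv_into X f y)"
  have s: "s \<in> Y \<rightarrow>\<^sub>E X" using assms(4) by (auto simp: s_def inv_into_into)
  have "compose Y f s = (\<lambda>y\<in>Y. y)"
    using assms(4) by (auto simp: s_def compose_def fun_eq_iff f_inv_into_f)
  then have *: "compose (TO M Y) (TM M X Y f) (TM M Y X s) = (\<lambda>y\<in>TO M Y. y)"
    using TM_compose[OF assms(2,1,2) s assms(3)] TM_id[OF assms(2)] by simp
  have "y \<in> TM M X Y f ` TO M X" if "y \<in> TO M Y" for y
  proof -
    have "TM M X Y f (TM M Y X s y) = y" using * that by (metis compose_eq restrict_apply')
    moreover have "TM M Y X s y \<in> TO M X" using TM_in[OF assms(2,1) s] that by auto
    ultimately show ?thesis by (metis imageI)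
  qed
  then show ?thesis using TM_in[OF assms(1,2,3)] by auto
qed

lemma TR_VRel: "small X \<Longrightarrow> small Y \<Longrightarrow> r \<in> VRel X Y \<Longrightarrow> TR M X Y r \<in> VRel (TO M X) (TO M Y)"
  using ext[unfolded flat_lax_extension_def, THEN conjunct1]
  by blast

lemma TR_mono: "small X \<Longrightarrow> small Y \<Longrightarrow> r \<in> VRel X Y \<Longrightarrow> s \<in> VRel X Y \<Longrightarrow> r \<le> s
    \<Longrightarrow> TR M X Y r \<le> TR M X Y s"
  using ext[unfolded flat_lax_extension_def, THEN conjunct2, THEN conjunct1]
  by blast

lemma TR_vcomp: "small X \<Longrightarrow> small Y \<Longrightarrow> small Z \<Longrightarrow> r \<in> VRel X Y \<Longrightarrow> s \<in> VRel Y Z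
    \<Longrightarrow> TR M Y Z s \<cdot> TR M X Y r \<le> TR M X Z (s \<cdot> r)"
  using ext[unfolded flat_lax_extension_def, THEN conjunct2, THEN conjunct2, THEN conjunct1]
  by blast

lemma TR_graph: "small X \<Longrightarrow> small Y \<Longrightarrow> f \<in> X \<rightarrow>\<^sub>E Y
    \<Longrightarrow> TR M X Y (graph X f) = graph (TO M X) (TM M X Y f)"
  using ext[unfolded flat_lax_extension_def, THEN conjunct2, THEN conjunct2, THEN conjunct2,
      THEN conjunct2, THEN conjunct1]
  by (simp add: Set_cat_def)

lemma TR_vconv: "small X \<Longrightarrow> small Y \<Longrightarrow> r \<in> VRel X Y
    \<Longrightarrow> TR M Y X (vconv r) = vconv (TR M X Y r)"
  using ext[unfolded flat_lax_extension_def, THEN conjunct2, THEN conjunct2, THEN conjunct2,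
      THEN conjunct2, THEN conjunct2, THEN conjunct1]
  by blast

text \<open>The hypothesis says \<open>r \<le> g\<degree> \<cdot> c \<cdot> f\<close>, equivalently \<open>g \<cdot> r \<cdot> f\<degree> \<le> c\<close>.  The second form can be
  compared with the composite of the extensions by lax functoriality alone, because flatness and
  compatibility with converses determine the extension on \<open>g\<close> and \<open>f\<degree>\<close>.\<close>

lemma TR_along_maps:
  assumes small: "small X" "small X'" "small Y" "small Y'"
    and f: "f \<in> X \<rightarrow>\<^sub>E X'" and g: "g \<in> Y \<rightarrow>\<^sub>E Y'"
    and r: "r \<in> VRel X Y" and c: "c \<in> VRel X' Y'"
    and le: "\<And>x y. x \<in> X \<Longrightarrow> y \<in> Y \<Longrightarrow> r x y \<le> c (f x) (g y)"
    and x: "x \<in> TO M X" and y: "y \<in> TO M Y"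
  shows "TR M X Y r x y \<le> TR M X' Y' c (TM M X X' f x) (TM M Y Y' g y)"
proof -
  let ?f = "vconv (graph X f) :: ('u, 'v) vrel" and ?g = "graph Y g :: ('u, 'v) vrel"
  have V: "?f \<in> VRel X' X" "?g \<in> VRel Y Y'" "?g \<cdot> r \<in> VRel X Y'" "?g \<cdot> r \<cdot> ?f \<in> VRel X' Y'"
    using f g r by (auto intro!: vconv_VRel graph_VRel vcomp_VRel)
  have "(?g \<cdot> r \<cdot> ?f) u v \<le> c u v" for u v
  proof -
    have "r z y \<le> c (f z) (g y)" if "z \<in> X" for z y
      using le that VRel_bot[OF r] by (cases "y \<in> Y") auto
    then have "?f u z * (?g \<cdot> r) z v \<le> c u v" for z
      by (auto simp: vconv_def graph_def[of X f] graph_vcomp_le_iff)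
    then show ?thesis by (auto simp: vcomp_le_iff)
  qed
  then have "?g \<cdot> r \<cdot> ?f \<le> c" by (simp add: le_fun_def)
  then have le_c: "TR M X' Y' (?g \<cdot> r \<cdot> ?f) \<le> TR M X' Y' c"
    using TR_mono small V c by blast
  have gr: "TR M Y Y' ?g (y) (TM M Y Y' g y) = 1"
    using TR_graph[OF small(3,4) g] y by (simp add: graph_def)
  have fr: "TR M X' X ?f (TM M X X' f x) x = 1"
    using TR_vconv[OF small(1,2) graph_VRel[OF f]] TR_graph[OF small(1,2) f] x
    by (simp add: graph_def vconv_def)
  have "TR M X Y r x y \<le> (TR M Y Y' ?g \<cdot> TR M X Y r) x (TM M Y Y' g y)"
    using vcomp_upper[of "TR M X Y r" x y "TR M Y Y' ?g" "TM M Y Y' g y"] gr by simp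
  also have "\<dots> \<le> TR M X Y' (?g \<cdot> r) x (TM M Y Y' g y)"
    using TR_vcomp[OF small(1,3,4) r V(2)] by (simp add: le_fun_def)
  also have "\<dots> \<le> (TR M X Y' (?g \<cdot> r) \<cdot> TR M X' X ?f) (TM M X X' f x) (TM M Y Y' g y)"
    using vcomp_upper[of "TR M X' X ?f" "TM M X X' f x" x "TR M X Y' (?g \<cdot> r)" "TM M Y Y' g y"] fr
    by simp
  also have "\<dots> \<le> TR M X' Y' (?g \<cdot> r \<cdot> ?f) (TM M X X' f x) (TM M Y Y' g y)"
    using TR_vcomp[OF small(2,1,4) V(1,3)] by (simp add: le_fun_def)
  also have "\<dots> \<le> TR M X' Y' c (TM M X X' f x) (TM M Y Y' g y)"
    using le_c by (simp add: le_fun_def)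
  finally show ?thesis .
qed

lemma is_space_iff:
  "is_space M (X, a) \<longleftrightarrow> small X \<and> a \<in> VRel (TO M X) X \<and>
    (\<forall>x\<in>X. 1 \<le> a (unit M X x) x) \<and>
    (\<forall>w\<in>TO M (TO M X). \<forall>t\<in>TO M X. \<forall>x\<in>X. TR M (TO M X) X a w t * a t x \<le> a (mult M X w) x)"
proof (cases "small X \<and> a \<in> VRel (TO M X) X")
  case True
  have "vid X \<le> a \<cdot> graph X (unit M X) \<longleftrightarrow> (\<forall>x\<in>X. 1 \<le> a (unit M X x) x)"
  proof
    assume "vid X \<le> a \<cdot> graph X (unit M X)"
    then have "vid X x x \<le> (a \<cdot> graph X (unit M X)) x x" for x by (simp add: le_fun_def)
    then show "\<forall>x\<in>X. 1 \<le> a (unit M X x) x" by (metis graph_def restrict_apply' vcomp_graph)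
  next
    assume "\<forall>x\<in>X. 1 \<le> a (unit M X x) x"
    then show "vid X \<le> a \<cdot> graph X (unit M X)"
      by (simp add: le_fun_def vcomp_graph) (simp add: graph_def)
  qed
  moreover have "a \<cdot> TR M (TO M X) X a \<le> a \<cdot> graph (TO M (TO M X)) (mult M X) \<longleftrightarrow>
      (\<forall>w\<in>TO M (TO M X). \<forall>t\<in>TO M X. \<forall>x\<in>X. TR M (TO M X) X a w t * a t x \<le> a (mult M X w) x)"
    (is "?L \<longleftrightarrow> ?R")
  proof
    assume ?L
    then have "(a \<cdot> TR M (TO M X) X a) w x \<le> a (mult M X w) x" if "w \<in> TO M (TO M X)" for w x
    proof -
      have "(a \<cdot> TR M (TO M X) X a) w x \<le> (a \<cdot> graph (TO M (TO M X)) (mult M X)) w x"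
        using \<open>?L\<close> by (simp add: le_fun_def)
      then show ?thesis using that by (simp add: vcomp_graph)
    qed
    then show ?R by (auto simp: vcomp_le_iff)
  next
    assume R: ?R
    have T: "TR M (TO M X) X a \<in> VRel (TO M (TO M X)) (TO M X)"
      using True TR_VRel TO_small by blast
    have "TR M (TO M X) X a w t * a t x \<le> (a \<cdot> graph (TO M (TO M X)) (mult M X)) w x" for w t x
    proof (cases "w \<in> TO M (TO M X) \<and> t \<in> TO M X \<and> x \<in> X")
      case True
      then show ?thesis using R by (simp add: vcomp_graph)
    next
      case False
      then have "TR M (TO M X) X a w t = bot \<or> a t x = bot"
        using T True by (meson VRel_bot)
      then show ?thesis by auto
    qed
    then show ?L by (simp add: le_fun_def vcomp_le_iff)
  qed
  ultimately show ?thesis by (simp add: is_space_def True)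
next
  case False
  then show ?thesis by (auto simp: is_space_def)
qed

lemma is_continuous_iff:
  assumes "a \<in> VRel (TO M X) X"
  shows "is_continuous M (X, a) (Y, b) f \<longleftrightarrow>
    f \<in> X \<rightarrow>\<^sub>E Y \<and> (\<forall>t\<in>TO M X. \<forall>x\<in>X. a t x \<le> b (TM M X Y f t) (f x))"
proof -
  have "graph X f \<cdot> a \<le> b \<cdot> graph (TO M X) (TM M X Y f) \<longleftrightarrow>
      (\<forall>t. \<forall>x\<in>X. a t x \<le> (if t \<in> TO M X then b (TM M X Y f t) (f x) else bot))"
    by (auto simp: le_fun_def vcomp_graph graph_vcomp_le_iff)
  also have "\<dots> \<longleftrightarrow> (\<forall>t\<in>TO M X. \<forall>x\<in>X. a t x \<le> b (TM M X Y f t) (f x))"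
    using VRel_bot[OF assms] by (auto split: if_splits)
  finally show ?thesis by (simp add: is_continuous_def)
qed

lemma Obj_TV_cat: "Obj (TV_cat M) = {A. is_space M A}"
  and Hom_TV_cat: "Hom (TV_cat M) A B = {f. is_continuous M A B f}"
  and Comp_TV_cat: "Comp (TV_cat M) A B C g f = compose (fst A) g f"
  by (simp_all add: TV_cat_def)

lemmas TV_cat_simps = Obj_TV_cat Hom_TV_cat Comp_TV_cat mem_Collect_eq

lemma space_small: "is_space M A \<Longrightarrow> small (fst A)"
  and space_VRel: "is_space M A \<Longrightarrow> snd A \<in> VRel (TO M (fst A)) (fst A)"
  by (cases A, simp add: is_space_iff)+

lemma continuous_iff:
  assumes "is_space M A"
  shows "is_continuous M A B f \<longleftrightarrow> f \<in> fst A \<rightarrow>\<^sub>E fst B \<and>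
    (\<forall>t\<in>TO M (fst A). \<forall>x\<in>fst A. snd A t x \<le> snd B (TM M (fst A) (fst B) f t) (f x))"
  using is_continuous_iff[OF space_VRel[OF assms], of "fst B" "snd B" f] by simp

lemma continuous_PiE: "is_continuous M A B f \<Longrightarrow> f \<in> fst A \<rightarrow>\<^sub>E fst B"
  by (simp add: is_continuous_def split: prod.splits)

lemma continuous_compose:
  assumes A: "is_space M A" and B: "is_space M B" and C: "is_space M C"
    and f: "is_continuous M A B f" and g: "is_continuous M B C g"
  shows "is_continuous M A C (compose (fst A) g f)"
proof -
  have f1: "f \<in> fst A \<rightarrow>\<^sub>E fst B" and g1: "g \<in> fst B \<rightarrow>\<^sub>E fst C"
    and f2: "\<And>t x. t \<in> TO M (fst A) \<Longrightarrow> x \<in> fst A \<Longrightarrow>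
      snd A t x \<le> snd B (TM M (fst A) (fst B) f t) (f x)"
    and g2: "\<And>t x. t \<in> TO M (fst B) \<Longrightarrow> x \<in> fst B \<Longrightarrow>
      snd B t x \<le> snd C (TM M (fst B) (fst C) g t) (g x)"
    using f g continuous_iff[OF A] continuous_iff[OF B] by blast+
  note small = A[THEN space_small] B[THEN space_small] C[THEN space_small]
  have "snd A t x \<le> snd C (TM M (fst A) (fst C) (compose (fst A) g f) t) (compose (fst A) g f x)"
    if "t \<in> TO M (fst A)" "x \<in> fst A" for t x
  proof -
    have "TM M (fst A) (fst B) f t \<in> TO M (fst B)" "f x \<in> fst B"
      using TM_in[OF small(1,2) f1] f1 that by auto
    then show ?thesis
      using order_trans[OF f2[OF that] g2] that TM_compose[OF small f1 g1]
      by (simp add: compose_eq)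
  qed
  then show ?thesis using compose_in_PiE[OF f1 g1] by (simp add: continuous_iff[OF A])
qed

lemma continuous_id: "is_space M A \<Longrightarrow> is_continuous M A A (\<lambda>x\<in>fst A. x)"
  by (simp add: continuous_iff TM_id space_small id_in_PiE)

text \<open>The largest structure on \<open>X\<close>.  Through it, universal properties of spaces say something about
  arbitrary maps of sets.\<close>

definition indiscrete :: "'u set \<Rightarrow> ('u, 'v) space" where
  "indiscrete X = (X, \<lambda>t x. if t \<in> TO M X \<and> x \<in> X then top else bot)"

lemma fst_indiscrete [simp]: "fst (indiscrete X) = X"
  by (simp add: indiscrete_def)

lemma indiscrete_is_space: "small X \<Longrightarrow> is_space M (indiscrete X)"
  using unit_in[of X] mult_in[of X]
  by (auto simp: indiscrete_def is_space_iff VRel_def)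

lemma continuous_indiscrete:
  assumes "is_space M A" "small X" "f \<in> fst A \<rightarrow>\<^sub>E X"
  shows "is_continuous M A (indiscrete X) f"
  using assms TM_in[OF space_small[OF assms(1)] assms(2,3)]
  by (auto simp: continuous_iff indiscrete_def)

definition initial :: "'u set \<Rightarrow> ('u \<Rightarrow> 'u) \<Rightarrow> ('u, 'v) space \<Rightarrow> ('u, 'v) vrel" where
  "initial X g B =
    (\<lambda>t x. if t \<in> TO M X \<and> x \<in> X then snd B (TM M X (fst B) g t) (g x) else bot)"

text \<open>Transitivity is inherited from \<open>B\<close> because \<open>g\<close> lifts to a map of the extended relations
  (\<open>TR_along_maps\<close>) and the multiplication is natural.\<close>

lemma initial_is_space:
  assumes X: "small X" and B: "is_space M B" and g: "g \<in> X \<rightarrow>\<^sub>E fst B"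
  shows "is_space M (X, initial X g B)"
proof -
  obtain Y b where B_eq: "B = (Y, b)" by (cases B)
  have g: "g \<in> X \<rightarrow>\<^sub>E Y" using g B_eq by simp
  have Y: "small Y" and b: "b \<in> VRel (TO M Y) Y"
    and refl: "\<And>y. y \<in> Y \<Longrightarrow> 1 \<le> b (unit M Y y) y"
    and trans: "\<And>w t y. w \<in> TO M (TO M Y) \<Longrightarrow> t \<in> TO M Y \<Longrightarrow> y \<in> Y \<Longrightarrow>
      TR M (TO M Y) Y b w t * b t y \<le> b (mult M Y w) y"
    using B unfolding B_eq is_space_iff by blast+
  let ?a = "initial X g B" and ?g = "TM M X Y g"
  let ?Tg = "TM M (TO M X) (TO M Y) ?g"
  have a: "?a t x = b (?g t) (g x)" if "t \<in> TO M X" "x \<in> X" for t x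
    using that by (simp add: initial_def B_eq)
  have aV: "?a \<in> VRel (TO M X) X" by (simp add: VRel_def initial_def)
  have Tg: "?g \<in> TO M X \<rightarrow>\<^sub>E TO M Y" using TM_in[OF X Y g] .
  have TTg: "?Tg \<in> TO M (TO M X) \<rightarrow>\<^sub>E TO M (TO M Y)"
    using TM_in[OF _ _ Tg] X Y by simp
  have "1 \<le> ?a (unit M X x) x" if "x \<in> X" for x
  proof -
    have "unit M X x \<in> TO M X" using unit_in[OF X] that by auto
    moreover have "g x \<in> Y" using g that by auto
    ultimately show ?thesis
      using refl[of "g x"] that by (simp add: a unit_natural[OF X Y g])
  qed
  moreover have "TR M (TO M X) X ?a w t * ?a t x \<le> ?a (mult M X w) x"
    if wtx: "w \<in> TO M (TO M X)" "t \<in> TO M X" "x \<in> X" for w t x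
  proof -
    have "TR M (TO M X) X ?a w t \<le> TR M (TO M Y) Y b (?Tg w) (?g t)"
      using TR_along_maps[OF _ _ X Y Tg g aV b _ wtx(1,2)] X Y a by auto
    then have "TR M (TO M X) X ?a w t * ?a t x \<le> TR M (TO M Y) Y b (?Tg w) (?g t) * b (?g t) (g x)"
      using a wtx by (simp add: mult_mono_quantale)
    also have "\<dots> \<le> b (mult M Y (?Tg w)) (g x)"
      using TTg Tg g wtx by (intro trans) auto
    also have "\<dots> = ?a (mult M X w) x"
      using mult_natural[OF X Y g wtx(1)] a[OF PiE_mem[OF mult_in[OF X] wtx(1)] wtx(3)] by simp
    finally show ?thesis .
  qed
  ultimately show ?thesis using X aV by (simp add: is_space_iff)
qed

lemma Inf_is_space:
  assumes X: "small X" and S: "\<And>b. b \<in> S \<Longrightarrow> is_space M (X, b)"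
    and a_def: "a = (\<lambda>t x. if t \<in> TO M X \<and> x \<in> X then INF b\<in>S. b t x else bot)"
  shows "is_space M (X, a)"
proof -
  have aV: "a \<in> VRel (TO M X) X" by (simp add: VRel_def a_def)
  have le: "a \<le> b" if "b \<in> S" for b
    using that by (auto simp: a_def le_fun_def intro: INF_lower)
  have "1 \<le> a (unit M X x) x" if "x \<in> X" for x
  proof -
    have "unit M X x \<in> TO M X" using unit_in[OF X] that by auto
    then show ?thesis using that S by (auto simp: a_def is_space_iff intro!: INF_greatest)
  qed
  moreover have "TR M (TO M X) X a w t * a t x \<le> a (mult M X w) x"
    if wtx: "w \<in> TO M (TO M X)" "t \<in> TO M X" "x \<in> X" for w t x
  proof -
    have "TR M (TO M X) X a w t * a t x \<le> b (mult M X w) x" if b: "b \<in> S" for b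
    proof -
      have "b \<in> VRel (TO M X) X" using S[OF b] by (simp add: is_space_iff)
      then have "TR M (TO M X) X a \<le> TR M (TO M X) X b"
        using TR_mono[OF _ X aV _ le[OF b]] X by simp
      then have "TR M (TO M X) X a w t * a t x \<le> TR M (TO M X) X b w t * b t x"
        using le[OF b] by (simp add: le_fun_def mult_mono_quantale)
      also have "\<dots> \<le> b (mult M X w) x" using S[OF b] wtx by (auto simp: is_space_iff)
      finally show ?thesis .
    qed
    moreover have "mult M X w \<in> TO M X" using mult_in[OF X] wtx by auto
    ultimately show ?thesis using wtx by (auto simp: a_def intro!: INF_greatest)
  qed
  ultimately show ?thesis using X aV by (simp add: is_space_iff)
qed


section \<open>Final structures and compact generation\<close>

definition final :: "'u set \<Rightarrow> (('u, 'v) space \<Rightarrow> ('u \<Rightarrow> 'u) set) \<Rightarrow> ('u, 'v) space" where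
  "final X Q = (X, \<lambda>t x. if t \<in> TO M X \<and> x \<in> X then
    INF b\<in>{b. is_space M (X, b) \<and> (\<forall>C\<in>CompHaus M. \<forall>\<alpha>\<in>Q C. is_continuous M C (X, b) \<alpha>)}. b t x
    else bot)"

lemma fst_final [simp]: "fst (final X Q) = X"
  by (simp add: final_def)

lemma final_is_space: "small X \<Longrightarrow> is_space M (final X Q)"
  unfolding final_def by (rule Inf_is_space[OF _ _ refl]) auto

lemma CompHaus_space: "C \<in> CompHaus M \<Longrightarrow> is_space M C"
  by (simp add: CompHaus_def)

lemma final_lift:
  assumes X: "small X" and Q: "\<And>C. C \<in> CompHaus M \<Longrightarrow> Q C \<subseteq> fst C \<rightarrow>\<^sub>E X"
    and C: "C \<in> CompHaus M" and \<alpha>: "\<alpha> \<in> Q C"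
  shows "is_continuous M C (final X Q) \<alpha>"
proof -
  have \<alpha>1: "\<alpha> \<in> fst C \<rightarrow>\<^sub>E X" using Q C \<alpha> by blast
  have "TM M (fst C) X \<alpha> \<in> TO M (fst C) \<rightarrow>\<^sub>E TO M X"
    using TM_in[OF space_small[OF CompHaus_space[OF C]] X \<alpha>1] .
  then show ?thesis
    using C \<alpha> \<alpha>1 by (auto simp: final_def continuous_iff CompHaus_space intro!: INF_greatest)
qed

text \<open>If \<open>g \<cdot> \<alpha>\<close> is continuous, then \<open>\<alpha>\<close> is continuous into the structure pulled back along \<open>g\<close>;
  that structure is therefore one of those whose infimum is the final structure.\<close>

lemma final_universal:
  assumes X: "small X" and Q: "\<And>C. C \<in> CompHaus M \<Longrightarrow> Q C \<subseteq> fst C \<rightarrow>\<^sub>E X"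
    and B: "is_space M B" and g: "g \<in> X \<rightarrow>\<^sub>E fst B"
    and cont: "\<And>C \<alpha>. C \<in> CompHaus M \<Longrightarrow> \<alpha> \<in> Q C \<Longrightarrow> is_continuous M C B (compose (fst C) g \<alpha>)"
  shows "is_continuous M (final X Q) B g"
proof -
  have "is_continuous M C (X, initial X g B) \<alpha>" if C: "C \<in> CompHaus M" and \<alpha>: "\<alpha> \<in> Q C" for C \<alpha>
  proof -
    have \<alpha>1: "\<alpha> \<in> fst C \<rightarrow>\<^sub>E X" using Q C \<alpha> by blast
    note Cs = CompHaus_space[OF C]
    note T = TM_compose[OF space_small[OF Cs] X space_small[OF B] \<alpha>1 g]
    have "TM M (fst C) X \<alpha> \<in> TO M (fst C) \<rightarrow>\<^sub>E TO M X"
      using TM_in[OF space_small[OF Cs] X \<alpha>1] .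
    then show ?thesis
      using cont[OF C \<alpha>] \<alpha>1 unfolding continuous_iff[OF Cs] T
      by (fastforce simp: initial_def compose_eq)
  qed
  then have "snd (final X Q) t x \<le> initial X g B t x" if "t \<in> TO M X" "x \<in> X" for t x
    using that initial_is_space[OF X B g] by (auto simp: final_def intro!: INF_lower)
  then show ?thesis
    using g by (simp add: continuous_iff[OF final_is_space[OF X]] initial_def)
qed

lemma compactly_generated_iff:
  "compactly_generated M A \<longleftrightarrow> is_space M A \<and>
    (\<forall>B g. is_space M B \<longrightarrow> g \<in> fst A \<rightarrow>\<^sub>E fst B \<longrightarrow>
      (\<forall>C\<in>CompHaus M. \<forall>p. is_continuous M C A p \<longrightarrow> is_continuous M C B (compose (fst C) g p))
      \<longrightarrow> is_continuous M A B g)" (is "_ \<longleftrightarrow> ?R")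
proof
  assume "compactly_generated M A"
  then show ?R unfolding compactly_generated_def TV_cat_simps by blast
next
  assume ?R
  then show "compactly_generated M A"
    unfolding compactly_generated_def TV_cat_simps
    using continuous_compose CompHaus_space by blast
qed

lemma final_compactly_generated:
  assumes X: "small X" and Q: "\<And>C. C \<in> CompHaus M \<Longrightarrow> Q C \<subseteq> fst C \<rightarrow>\<^sub>E X"
  shows "compactly_generated M (final X Q)"
  unfolding compactly_generated_iff
  using final_is_space[OF X] final_lift[OF X Q] final_universal[OF X Q] by simp

lemma fst_assoc [simp]: "fst (assoc_quasi_space M A) = fst A"
  by (simp add: assoc_quasi_space_def)

lemma snd_assoc:
  "C \<in> CompHaus M \<Longrightarrow> snd (assoc_quasi_space M A) C = {f. is_continuous M C A f}"
  by (simp add: assoc_quasi_space_def TV_cat_def)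

lemma quasi_continuous_iff_continuous:
  assumes A: "compactly_generated M A" and B: "is_space M B"
  shows "quasi_continuous M (assoc_quasi_space M A) (assoc_quasi_space M B) f
    \<longleftrightarrow> is_continuous M A B f"
proof
  assume "is_continuous M A B f"
  moreover have "is_space M A" using A by (simp add: compactly_generated_iff)
  ultimately show "quasi_continuous M (assoc_quasi_space M A) (assoc_quasi_space M B) f"
    using continuous_compose CompHaus_space B
    by (auto simp: quasi_continuous_def snd_assoc continuous_iff)
next
  assume "quasi_continuous M (assoc_quasi_space M A) (assoc_quasi_space M B) f"
  then show "is_continuous M A B f"
    using A B unfolding quasi_continuous_def compactly_generated_iff
    by (simp add: snd_assoc)
qed

text \<open>Both identity maps between the two spaces are continuous.\<close>

lemma assoc_inj:
  assumes A: "compactly_generated M A" and B: "compactly_generated M B"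
    and eq: "assoc_quasi_space M A = assoc_quasi_space M B"
  shows "A = B"
proof -
  have le: "snd A \<le> snd B"
    if A: "compactly_generated M A" and B: "compactly_generated M B"
      and eq: "assoc_quasi_space M A = assoc_quasi_space M B" for A B
  proof -
    have As: "is_space M A" and Bs: "is_space M B"
      using A B by (simp_all add: compactly_generated_iff)
    have X: "fst A = fst B" using eq by (metis fst_assoc)
    have "quasi_continuous M (assoc_quasi_space M A) (assoc_quasi_space M A) (\<lambda>x\<in>fst A. x)"
      using quasi_continuous_iff_continuous[OF A As] continuous_id[OF As] by simp
    then have "is_continuous M A B (\<lambda>x\<in>fst A. x)"
      using quasi_continuous_iff_continuous[OF A Bs] eq by simp
    then have "snd A t x \<le> snd B t x" if "t \<in> TO M (fst A)" "x \<in> fst A" for t x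
      using that X TM_id[OF space_small[OF As]] by (simp add: continuous_iff[OF As])
    moreover have "snd A t x = bot" if "\<not> (t \<in> TO M (fst A) \<and> x \<in> fst A)" for t x
      using VRel_bot[OF space_VRel[OF As]] that by blast
    ultimately show ?thesis unfolding le_fun_def by (metis bot_least)
  qed
  have "fst A = fst B" using eq by (metis fst_assoc)
  moreover have "snd A = snd B" using le[OF A B eq] le[OF B A eq[symmetric]] by (rule antisym)
  ultimately show ?thesis by (rule prod_eqI)
qed


section \<open>Covers by compact Hausdorff spaces\<close>

lemma coproduct_universal:
  assumes "is_coproduct (TV_cat M) I F D \<iota>" and "is_space M B"
    and "\<And>i. i \<in> I \<Longrightarrow> is_continuous M (F i) B (f i)"
  shows "\<exists>!h. is_continuous M D B h \<and> (\<forall>i\<in>I. compose (fst (F i)) h (\<iota> i) = f i)"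
  using assms(1)[unfolded is_coproduct_def TV_cat_simps, THEN conjunct2, THEN conjunct2,
      rule_format, of B f] assms(2,3) by simp

text \<open>The map \<open>f\<close> carries no structure to test against, but all maps into the indiscrete space on
  \<open>Z\<close> are continuous, so the uniqueness part of the universal property applies to it.\<close>

lemma coproduct_map_unique:
  assumes cop: "is_coproduct (TV_cat M) I F D \<iota>" and Z: "small Z"
    and f: "f \<in> fst D \<rightarrow>\<^sub>E Z" and g: "g \<in> fst D \<rightarrow>\<^sub>E Z"
    and eq: "\<And>i. i \<in> I \<Longrightarrow> compose (fst (F i)) f (\<iota> i) = compose (fst (F i)) g (\<iota> i)"
  shows "f = g"
proof -
  have D: "is_space M D" and F: "\<And>i. i \<in> I \<Longrightarrow> is_space M (F i)"
    and \<iota>: "\<And>i. i \<in> I \<Longrightarrow> is_continuous M (F i) D (\<iota> i)"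
    using cop by (simp_all add: is_coproduct_def TV_cat_def)
  have f': "is_continuous M D (indiscrete Z) f" and g': "is_continuous M D (indiscrete Z) g"
    using continuous_indiscrete[OF D Z] f g by blast+
  have "is_continuous M (F i) (indiscrete Z) (compose (fst (F i)) g (\<iota> i))" if "i \<in> I" for i
    using continuous_compose[OF F D indiscrete_is_space[OF Z] \<iota> g'] that by blast
  then have "\<exists>!h. is_continuous M D (indiscrete Z) h \<and>
      (\<forall>i\<in>I. compose (fst (F i)) h (\<iota> i) = compose (fst (F i)) g (\<iota> i))"
    using coproduct_universal[OF cop indiscrete_is_space[OF Z]] by simp
  then show ?thesis using f' g' eq by blast
qed

text \<open>Lift \<open>t \<in> T C\<close> to some \<open>t' \<in> T D\<close>.  By compactness \<open>t'\<close> converges in \<open>D\<close> to certain points \<open>z\<close>,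
  and since limits in \<open>C\<close> are unique, \<open>\<eta> z\<close> is the limit of \<open>t\<close>.  Quantitatively, compactness
  contributes two factors \<open>d t' z\<close>: one of them cancels against \<open>c t y\<close> by the Hausdorff
  property, the other bounds the convergence of the images in \<open>B\<close>.\<close>

lemma surjection_final:
  assumes D: "is_space M D" "is_compact M D" and C: "is_space M C" "is_Hausdorff M C"
    and B: "is_space M B" and \<eta>: "is_continuous M D C \<eta>" and surj: "\<eta> ` fst D = fst C"
    and \<alpha>: "\<alpha> \<in> fst C \<rightarrow>\<^sub>E fst B" and cont: "is_continuous M D B (compose (fst D) \<alpha> \<eta>)"
  shows "is_continuous M C B \<alpha>"
proof -
  obtain Z d where D_eq: "D = (Z, d)" by (cases D)
  obtain Y c where C_eq: "C = (Y, c)" by (cases C)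
  obtain X b where B_eq: "B = (X, b)" by (cases B)
  have small: "small Z" "small Y" "small X"
    using D(1) C(1) B by (auto simp: D_eq C_eq B_eq is_space_iff)
  have d: "d \<in> VRel (TO M Z) Z" using D(1) by (simp add: D_eq is_space_iff)
  have \<eta>1: "\<eta> \<in> Z \<rightarrow>\<^sub>E Y"
    and \<eta>2: "\<And>t z. t \<in> TO M Z \<Longrightarrow> z \<in> Z \<Longrightarrow> d t z \<le> c (TM M Z Y \<eta> t) (\<eta> z)"
    using \<eta> D(1) by (auto simp: continuous_iff D_eq C_eq)
  have \<alpha>1: "\<alpha> \<in> Y \<rightarrow>\<^sub>E X" using \<alpha> by (simp add: C_eq B_eq)
  have \<alpha>2: "d t z \<le> b (TM M Y X \<alpha> (TM M Z Y \<eta> t)) (\<alpha> (\<eta> z))" if "t \<in> TO M Z" "z \<in> Z" for t z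
    using cont D(1) that TM_compose[OF small \<eta>1 \<alpha>1]
    by (auto simp: continuous_iff D_eq B_eq compose_eq)
  have comp: "1 \<le> (SUP z. d t z * d t z)" if "t \<in> TO M Z" for t
    using D(2) that unfolding is_compact_def D_eq
    by (auto simp: le_fun_def vcomp_def vconv_def graph_def split: if_splits)
  have haus: "c t x * c t y \<le> (if x = y then 1 else bot)" for t x y
  proof -
    have "c t x * c t y \<le> (c \<cdot> vconv c) x y"
      using vcomp_upper[of "vconv c" x t c y] by (simp add: vconv_def)
    also have "\<dots> \<le> vid Y x y" using C(2) by (simp add: is_Hausdorff_def C_eq le_fun_def)
    also have "\<dots> \<le> (if x = y then 1 else bot)" by (simp add: graph_def)
    finally show ?thesis .
  qed
  have "c t y \<le> b (TM M Y X \<alpha> t) (\<alpha> y)" if t: "t \<in> TO M Y" and y: "y \<in> Y" for t y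
  proof -
    obtain t' where t': "t' \<in> TO M Z" "t = TM M Z Y \<eta> t'"
      using TM_surj[OF small(1,2) \<eta>1] surj t by (auto simp: D_eq C_eq)
    have "c t y * (d t' z * d t' z) \<le> b (TM M Y X \<alpha> t) (\<alpha> y)" for z
    proof (cases "z \<in> Z")
      case True
      have "c t y * (d t' z * d t' z) \<le> c t y * (c t (\<eta> z) * d t' z)"
        using \<eta>2[OF t'(1) True] t'(2) by (simp add: mult_mono_quantale)
      also have "\<dots> \<le> (if y = \<eta> z then 1 else bot) * d t' z"
        unfolding mult.assoc[symmetric] by (intro mult_mono_quantale haus order_refl)
      also have "\<dots> \<le> b (TM M Y X \<alpha> t) (\<alpha> y)"
        using \<alpha>2[OF t'(1) True] t'(2) by simp
      finally show ?thesis .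
    next
      case False
      then have "d t' z = bot" using VRel_bot[OF d] by blast
      then show ?thesis by simp
    qed
    then have "(SUP z. c t y * (d t' z * d t' z)) \<le> b (TM M Y X \<alpha> t) (\<alpha> y)"
      by (simp add: SUP_le_iff)
    moreover have "c t y * (SUP z. d t' z * d t' z) = (SUP z. c t y * (d t' z * d t' z))"
      by (simp add: mult_Sup image_image)
    moreover have "c t y \<le> c t y * (SUP z. d t' z * d t' z)"
      using mult_right_mono_quantale[OF comp[OF t'(1)], of "c t y"] by simp
    ultimately show ?thesis by simp
  qed
  then show ?thesis using \<alpha>1 C(1) by (simp add: continuous_iff C_eq B_eq)
qed

text \<open>A space is the coproduct of the family consisting of itself, with the identity as injection.\<close>

lemma covered_self:
  assumes C: "is_space M C" and \<alpha>: "\<alpha> \<in> fst C \<rightarrow>\<^sub>E X"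
  shows "covered M C \<alpha> {0::nat} (\<lambda>_. C) (\<lambda>_. \<alpha>)"
proof -
  let ?id = "\<lambda>x\<in>fst C. x"
  have id: "is_continuous M C C ?id" using continuous_id[OF C] .
  have "is_coproduct (TV_cat M) {0::nat} (\<lambda>_. C) C (\<lambda>_. ?id)"
  proof -
    have "compose (fst C) h ?id = h" if "is_continuous M C Z h" for h Z
      using compose_id_right[OF continuous_PiE[OF that]] .
    then show ?thesis using C id unfolding is_coproduct_def TV_cat_simps
      by auto
  qed
  moreover have "?id \<in> Hom (TV_cat M) C C"
    using id by (simp add: Hom_TV_cat)
  moreover have "?id ` fst C = fst C"
    by simp
  moreover have "compose (fst C) (compose (fst C) \<alpha> ?id) ?id = \<alpha>"
    using compose_id_right[OF \<alpha>] by simp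
  ultimately show ?thesis unfolding covered_def by blast
qed

lemma covered_continuous:
  assumes cop_closed: "closed_under_finite_coproducts (TV_cat M) (CompHaus M)"
    and A: "is_space M A" and C: "C \<in> CompHaus M" and \<alpha>: "\<alpha> \<in> fst C \<rightarrow>\<^sub>E fst A"
    and I: "finite (I :: nat set)" and Cs: "\<And>i. i \<in> I \<Longrightarrow> Cs i \<in> CompHaus M"
    and \<alpha>s: "\<And>i. i \<in> I \<Longrightarrow> is_continuous M (Cs i) A (\<alpha>s i)"
    and cov: "covered M C \<alpha> I Cs \<alpha>s"
  shows "is_continuous M C A \<alpha>"
proof -
  obtain D \<iota> \<eta> where cop: "is_coproduct (TV_cat M) I Cs D \<iota>"
    and \<eta>: "is_continuous M D C \<eta>" and surj: "\<eta> ` fst D = fst C"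
    and ind: "\<And>i. i \<in> I \<Longrightarrow> compose (fst (Cs i)) (compose (fst D) \<alpha> \<eta>) (\<iota> i) = \<alpha>s i"
    using cov by (auto simp: covered_def TV_cat_def)
  have "D \<in> CompHaus M"
    using cop_closed I Cs cop unfolding closed_under_finite_coproducts_def by blast
  then have D: "is_space M D" "is_compact M D" by (simp_all add: CompHaus_def)
  have C': "is_space M C" "is_Hausdorff M C" using C by (simp_all add: CompHaus_def)
  have "\<exists>h. is_continuous M D A h \<and> (\<forall>i\<in>I. compose (fst (Cs i)) h (\<iota> i) = \<alpha>s i)"
    using coproduct_universal[OF cop A, of \<alpha>s] \<alpha>s by blast
  then obtain h where h: "is_continuous M D A h"
    and h_ind: "\<And>i. i \<in> I \<Longrightarrow> compose (fst (Cs i)) h (\<iota> i) = \<alpha>s i" by blast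
  have "compose (fst D) \<alpha> \<eta> = h"
  proof (rule coproduct_map_unique[OF cop space_small[OF A]])
    show "compose (fst D) \<alpha> \<eta> \<in> fst D \<rightarrow>\<^sub>E fst A"
      by (rule compose_in_PiE[OF continuous_PiE[OF \<eta>] \<alpha>])
    show "h \<in> fst D \<rightarrow>\<^sub>E fst A" by (rule continuous_PiE[OF h])
  qed (simp add: ind h_ind)
  then show ?thesis using surjection_final[OF D C' A \<eta> surj \<alpha>] h by simp
qed

lemma assoc_is_quasi_space:
  assumes const: "constants_continuous M"
    and cop_closed: "closed_under_finite_coproducts (TV_cat M) (CompHaus M)"
    and A: "is_space M A"
  shows "is_quasi_space M (assoc_quasi_space M A)"
proof -
  let ?Q = "\<lambda>C. {f. is_continuous M C A f}"
  have sub: "?Q C \<subseteq> fst C \<rightarrow>\<^sub>E fst A" if "C \<in> CompHaus M" for C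
    using continuous_iff[OF CompHaus_space[OF that]] by blast
  have "constant_maps (fst C) (fst A) \<subseteq> ?Q C" if "C \<in> CompHaus M" for C
    using const CompHaus_space[OF that] A unfolding constants_continuous_def TV_cat_simps
    by blast
  moreover have "compose (fst C1) \<alpha> h \<in> ?Q C1"
    if "C1 \<in> CompHaus M" "C2 \<in> CompHaus M" "is_continuous M C1 C2 h" "\<alpha> \<in> ?Q C2" for C1 C2 h \<alpha>
    using that continuous_compose[OF _ _ A] CompHaus_space by blast
  moreover have "\<alpha> \<in> ?Q C \<longleftrightarrow>
      (\<exists>(I::nat set) Cs \<alpha>s. finite I \<and> (\<forall>i\<in>I. Cs i \<in> CompHaus M \<and> \<alpha>s i \<in> ?Q (Cs i)) \<and>
        covered M C \<alpha> I Cs \<alpha>s)" (is "_ \<longleftrightarrow> ?R")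
    if C: "C \<in> CompHaus M" and \<alpha>: "\<alpha> \<in> fst C \<rightarrow>\<^sub>E fst A" for C \<alpha>
  proof
    assume "\<alpha> \<in> ?Q C"
    then have "finite {0::nat} \<and> (\<forall>i\<in>{0::nat}. C \<in> CompHaus M \<and> \<alpha> \<in> ?Q C) \<and>
        covered M C \<alpha> {0::nat} (\<lambda>_. C) (\<lambda>_. \<alpha>)"
      using C covered_self[OF CompHaus_space[OF C] \<alpha>] by simp
    then show ?R
      by (intro exI[of _ "{0::nat}"] exI[of _ "\<lambda>_. C"] exI[of _ "\<lambda>_. \<alpha>"])
  next
    assume ?R
    then show "\<alpha> \<in> ?Q C" using covered_continuous[OF cop_closed A C \<alpha>] by blast
  qed
  ultimately show ?thesis
    using space_small[OF A] sub
    unfolding is_quasi_space_def assoc_quasi_space_def TV_cat_def by (simp cong: conj_cong)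
qed


section \<open>The reflection\<close>

lemma Qs_is_category: "is_category (Qs_cat M)"
proof -
  have PiE: "f \<in> fst A \<rightarrow>\<^sub>E fst B" if "quasi_continuous M A B f" for A B f
    using that by (simp add: quasi_continuous_def)
  have adm: "\<alpha> \<in> fst C \<rightarrow>\<^sub>E fst A"
    if "is_quasi_space M A" "C \<in> CompHaus M" "\<alpha> \<in> snd A C" for A C \<alpha>
    using that unfolding is_quasi_space_def by (cases A) (simp, blast)
  have "quasi_continuous M A A (\<lambda>x\<in>fst A. x)" if "is_quasi_space M A" for A
    using adm[OF that] by (simp add: quasi_continuous_def compose_id_left id_in_PiE)
  moreover have "quasi_continuous M A C (compose (fst A) g f)"
    if A: "is_quasi_space M A" and f: "quasi_continuous M A B f" and g: "quasi_continuous M B C g"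
    for A B C f g
  proof -
    have "compose (fst K) (compose (fst A) g f) \<alpha> \<in> snd C K"
      if K: "K \<in> CompHaus M" and \<alpha>: "\<alpha> \<in> snd A K" for K \<alpha>
    proof -
      have "compose (fst K) (compose (fst A) g f) \<alpha> = compose (fst K) g (compose (fst K) f \<alpha>)"
        using adm[OF A K \<alpha>] by (intro compose_compose) auto
      then show ?thesis using f g K \<alpha> by (simp add: quasi_continuous_def)
    qed
    then show ?thesis
      using compose_in_PiE[OF PiE[OF f] PiE[OF g]] by (simp add: quasi_continuous_def)
  qed
  moreover have "compose (fst A) f (\<lambda>x\<in>fst A. x) = f \<and> compose (fst A) (\<lambda>x\<in>fst B. x) f = f"
    if "quasi_continuous M A B f" for A B f
    using PiE[OF that] compose_id_left compose_id_right by blast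
  moreover have "compose (fst A) (compose (fst B) h g) f = compose (fst A) h (compose (fst A) g f)"
    if "quasi_continuous M A B f" for A B f g h
    using PiE[OF that] by (intro compose_compose) auto
  ultimately show ?thesis unfolding is_category_def Qs_cat_def by (simp, blast)
qed

lemma Hom_C_TV_cat:
  assumes A: "compactly_generated M A" and B: "compactly_generated M B"
  shows "Hom (C_TV_cat M) (assoc_quasi_space M A) (assoc_quasi_space M B)
    = {f. is_continuous M A B f}"
proof -
  have "Hom (C_TV_cat M) (assoc_quasi_space M A) (assoc_quasi_space M B) =
      {f. \<exists>A' B'. compactly_generated M A' \<and> compactly_generated M B' \<and>
        assoc_quasi_space M A = assoc_quasi_space M A' \<and>
        assoc_quasi_space M B = assoc_quasi_space M B' \<and> is_continuous M A' B' f}"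
    by (simp add: C_TV_cat_def Hom_TV_cat)
  then show ?thesis using A B assoc_inj by blast
qed

lemma full_subcategoryI:
  assumes K: "is_category K" and Obj: "Obj S \<subseteq> Obj K"
    and Hom: "\<And>A B. A \<in> Obj S \<Longrightarrow> B \<in> Obj S \<Longrightarrow> Hom S A B = Hom K A B"
    and ops: "Comp S = Comp K" "Ident S = Ident K"
  shows "is_full_subcategory S K"
proof -
  have "is_category S"
    unfolding is_category_def ops
  proof (intro conjI ballI)
    fix A assume A: "A \<in> Obj S"
    then show "Ident K A \<in> Hom S A A"
      using K Obj unfolding Hom[OF A A] is_category_def by blast
  next
    fix A B C f g
    assume o: "A \<in> Obj S" "B \<in> Obj S" "C \<in> Obj S" and h: "f \<in> Hom S A B" "g \<in> Hom S B C"
    then have "f \<in> Hom K A B" "g \<in> Hom K B C" by (simp_all add: Hom)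
    then show "Comp K A B C g f \<in> Hom S A C"
      using K Obj o unfolding Hom[OF o(1,3)] is_category_def by blast
  next
    fix A B f assume o: "A \<in> Obj S" "B \<in> Obj S" and "f \<in> Hom S A B"
    then have "f \<in> Hom K A B" by (simp add: Hom)
    then show "Comp K A A B f (Ident K A) = f" "Comp K A B B (Ident K B) f = f"
      using K Obj o unfolding is_category_def by blast+
  next
    fix A B C D f g h
    assume o: "A \<in> Obj S" "B \<in> Obj S" "C \<in> Obj S" "D \<in> Obj S"
      and "f \<in> Hom S A B" "g \<in> Hom S B C" "h \<in> Hom S C D"
    then have "f \<in> Hom K A B" "g \<in> Hom K B C" "h \<in> Hom K C D" by (simp_all add: Hom)
    then show "Comp K A B D (Comp K B C D h g) f = Comp K A C D h (Comp K A B C g f)"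
      using K Obj o unfolding is_category_def by (meson subsetD)
  qed
  then show ?thesis
    using K Obj Hom by (simp add: is_full_subcategory_def is_subcategory_def ops)
qed

lemma C_TV_full_subcategory:
  assumes "constants_continuous M"
    and "closed_under_finite_coproducts (TV_cat M) (CompHaus M)"
  shows "is_full_subcategory (C_TV_cat M) (Qs_cat M)"
proof (rule full_subcategoryI[OF Qs_is_category])
  show "Obj (C_TV_cat M) \<subseteq> Obj (Qs_cat M)"
    using assoc_is_quasi_space[OF assms]
    by (auto simp: C_TV_cat_def Qs_cat_def compactly_generated_iff)
  show "Hom (C_TV_cat M) A B = Hom (Qs_cat M) A B"
    if AB: "A \<in> Obj (C_TV_cat M)" "B \<in> Obj (C_TV_cat M)" for A B
  proof -
    obtain A' B' where A': "compactly_generated M A'" "A = assoc_quasi_space M A'"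
      and B': "compactly_generated M B'" "B = assoc_quasi_space M B'"
      using AB by (auto simp: C_TV_cat_def)
    have "is_space M B'" using B'(1) by (simp add: compactly_generated_iff)
    then show ?thesis
      using Hom_C_TV_cat[OF A'(1) B'(1)] quasi_continuous_iff_continuous[OF A'(1), of B']
      by (auto simp: A'(2) B'(2) Qs_cat_def)
  qed
qed (simp_all add: C_TV_cat_def Qs_cat_def)

lemma final_is_reflection:
  assumes "is_quasi_space M (X, Q)"
  shows "is_reflection (C_TV_cat M) (Qs_cat M) (X, Q) (assoc_quasi_space M (final X Q)) (\<lambda>x\<in>X. x)"
proof -
  let ?F = "final X Q"
  have X: "small X" and Q: "\<And>C. C \<in> CompHaus M \<Longrightarrow> Q C \<subseteq> fst C \<rightarrow>\<^sub>E X"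
    using assms by (simp_all add: is_quasi_space_def)
  have F: "compactly_generated M ?F" using final_compactly_generated[OF X Q] by blast
  have "compose (fst C) (\<lambda>x\<in>X. x) \<alpha> = \<alpha>" if "C \<in> CompHaus M" "\<alpha> \<in> Q C" for C \<alpha>
    by (rule compose_id_left[OF subsetD[OF Q[OF that(1)] that(2)]])
  then have r: "quasi_continuous M (X, Q) (assoc_quasi_space M ?F) (\<lambda>x\<in>X. x)"
    using final_lift[OF X Q] by (auto simp: quasi_continuous_def snd_assoc)
  have "\<exists>!g. g \<in> Hom (C_TV_cat M) (assoc_quasi_space M ?F) (assoc_quasi_space M B) \<and>
      compose X g (\<lambda>x\<in>X. x) = f"
    if B: "compactly_generated M B" and f: "quasi_continuous M (X, Q) (assoc_quasi_space M B) f"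
    for B f
  proof -
    have Bs: "is_space M B" using B by (simp add: compactly_generated_iff)
    have f1: "f \<in> X \<rightarrow>\<^sub>E fst B" using f by (simp add: quasi_continuous_def)
    have "is_continuous M ?F B f"
      using final_universal[OF X Q Bs f1] f by (auto simp: quasi_continuous_def snd_assoc)
    moreover have "compose X g (\<lambda>x\<in>X. x) = g" if "is_continuous M ?F B g" for g
      using that continuous_iff[OF final_is_space[OF X]] compose_id_right by fastforce
    ultimately show ?thesis unfolding Hom_C_TV_cat[OF F B] by (intro ex1I[of _ f]) auto
  qed
  then show ?thesis
    using F r by (auto simp: is_reflection_def C_TV_cat_def Qs_cat_def)
qed

end

theorem mainTheorem4:
  fixes M :: "('u, 'v::heyting_quantale) lax_monad"
  assumes "infinite (UNIV :: 'u set)"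
    and "set_monad M"
    and "BC M"
    and "flat_lax_extension M"
    and "constants_continuous M"
    and "closed_under_finite_coproducts (TV_cat M) (CompHaus M)"
    and "closed_under_binary_products (TV_cat M) (CompHaus M)"
    and "closed_under_equalizers (TV_cat M) (CompHaus M)"
  shows "is_full_subcategory (C_TV_cat M) (Qs_cat M) \<and>
    is_reflective_subcategory (C_TV_cat M) (Qs_cat M)"
proof -
  interpret lax_extended_monad M using assms(2,4) by unfold_locales
  have full: "is_full_subcategory (C_TV_cat M) (Qs_cat M)"
    using C_TV_full_subcategory assms(5,6) by blast
  moreover have "\<exists>A r. is_reflection (C_TV_cat M) (Qs_cat M) B A r" if "B \<in> Obj (Qs_cat M)" for B
    using that final_is_reflection by (cases B) (auto simp: Qs_cat_def)
  ultimately show ?thesis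
    by (simp add: is_reflective_subcategory_def is_full_subcategory_def)
qed

end
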